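(* Let $(X,d)$ be a separable quasi-metric space and $\mu$ a Borel measure on $X$ such that $\mu(X)<\infty$. Then a subset $\mathcal F$ of $L^0(X,\mu)$ is totally bounded if the following condition holds: for any $\varepsilon\in(0,\infty)$ there exist $\delta\in(0,\infty)$ and $\lambda\in(0,\infty)$ such that for any $u\in\mathcal F$ there is a measurable set $E(u)\subseteq X$ satisfying (i) $\mu(E(u))<\varepsilon$, (ii) $|u(x)-u(y)|<\varepsilon$ for any $x,y\in X\setminus E(u)$ with $d(x,y)<\delta$, (iii) $|u(x)|\le\lambda$ for $x\in X\setminus E(u)$. On the other hand, if $\mu$ is a Borel regular measure and every open set $U\subseteq X$ can be written as $U=F\cup Z$, where $F$ is an $F_\sigma$-set and $Z$ is a null set, then the condition "for any $\varepsilon\in(0,\infty)$ there exist $\delta\in(0,\infty)$ and $\lambda\in(0,\infty)$ such that for any $u\in\mathcal F$ there is a measurable set $E(u)\subseteq X$ satisfying (i), (ii) and (iii)" is also necessary for $\mathcal F$ to be totally bounded in $L^0(X,\mu)$.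
   Context: A quasi-metric space $(X,d)$ is a set $X$ with at least two elements and a function $d:X\times X\to[0,\infty)$ for which there are constants $C_0,C_1\in(0,\infty)$ such that for all $x,y,z\in X$: $d(x,y)=0$ iff $x=y$; $d(y,x)\le C_0 d(x,y)$; $d(x,y)\le C_1\max\{d(x,z),d(z,y)\}$ (symmetry is not required). $B_d(x,r):=\{y\in X:d(x,y)<r\}$. The topology $\tau_d$ consists of all $\mathcal O\subseteq X$ such that for each $x\in\mathcal O$ there is $r>0$ with $B_d(x,r)\subseteq\mathcal O$; separability, open sets and $F_\sigma$-sets refer to $\tau_d$. A Borel measure is a nonnegative measure on a $\sigma$-algebra $\mathfrak M$ of subsets of $X$ containing (but not necessarily equal to) the Borel $\sigma$-algebra of $\tau_d$; it is Borel regular if every set in $\mathfrak M$ is contained in a Borel set of equal measure. For $\mu(X)<\infty$, $L^0(X,\mu)$ is the space of (equivalence classes, modulo equality $\mu$-a.e., of) measurable functions on $X$ that are finite a.e., with the metric $d_{L^0}(f,g):=\int_X\frac{|f-g|}{1+|f-g|}\,d\mu$. *)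

theory Defs
  imports "HOL-Analysis.Analysis"
begin

definition quasi_metric_space :: "'a set \<Rightarrow> ('a \<Rightarrow> 'a \<Rightarrow> real) \<Rightarrow> bool" where
  "quasi_metric_space X d \<longleftrightarrow>
     (\<exists>x\<in>X. \<exists>y\<in>X. x \<noteq> y) \<and>
     (\<forall>x\<in>X. \<forall>y\<in>X. 0 \<le> d x y) \<and>
     (\<exists>C0>0. \<exists>C1>0. \<forall>x\<in>X. \<forall>y\<in>X. \<forall>z\<in>X.
        (d x y = 0 \<longleftrightarrow> x = y) \<and>
        d y x \<le> C0 * d x y \<and>
        d x y \<le> C1 * max (d x z) (d z y))"

definition qball :: "'a set \<Rightarrow> ('a \<Rightarrow> 'a \<Rightarrow> real) \<Rightarrow> 'a \<Rightarrow> real \<Rightarrow> 'a set" where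
  "qball X d x r = {y \<in> X. d x y < r}"

text \<open>Balls need not be open in this topology.\<close>

definition qtopology :: "'a set \<Rightarrow> ('a \<Rightarrow> 'a \<Rightarrow> real) \<Rightarrow> 'a topology" where
  "qtopology X d = topology (\<lambda>U. U \<subseteq> X \<and> (\<forall>x\<in>U. \<exists>r>0. qball X d x r \<subseteq> U))"

lemma openin_qtopology:
  "openin (qtopology X d) U \<longleftrightarrow> U \<subseteq> X \<and> (\<forall>x\<in>U. \<exists>r>0. qball X d x r \<subseteq> U)"
proof -
  have "istopology (\<lambda>U. U \<subseteq> X \<and> (\<forall>x\<in>U. \<exists>r>0. qball X d x r \<subseteq> U))" (is "istopology ?P")
    unfolding istopology_def
  proof (intro conjI allI impI)
    fix S T assume S: "?P S" and T: "?P T"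
    show "S \<inter> T \<subseteq> X" using S by blast
    show "\<forall>x\<in>S \<inter> T. \<exists>r>0. qball X d x r \<subseteq> S \<inter> T"
    proof
      fix x assume "x \<in> S \<inter> T"
      then obtain r s where rs: "r > 0" "qball X d x r \<subseteq> S" "s > 0" "qball X d x s \<subseteq> T"
        using S T by blast
      then have "qball X d x (min r s) \<subseteq> S \<inter> T"
        by (auto simp: qball_def)
      then show "\<exists>r>0. qball X d x r \<subseteq> S \<inter> T"
        using rs by (intro exI[of _ "min r s"]) auto
    qed
  next
    fix K assume K: "\<forall>S\<in>K. ?P S"
    then show "\<Union>K \<subseteq> X" by blast
    show "\<forall>x\<in>\<Union>K. \<exists>r>0. qball X d x r \<subseteq> \<Union>K"
      using K by (meson UnionE Union_upper subset_trans)
  qed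
  then show ?thesis
    by (simp add: qtopology_def topology_inverse')
qed

lemma topspace_qtopology [simp]: "topspace (qtopology X d) = X"
proof -
  have "openin (qtopology X d) X"
    unfolding openin_qtopology by (auto simp: qball_def intro: exI[of _ 1])
  then show ?thesis
    by (metis openin_qtopology openin_subset openin_topspace subset_antisym)
qed

definition separable_topology :: "'a topology \<Rightarrow> bool" where
  "separable_topology T \<longleftrightarrow>
     (\<exists>D. countable D \<and> D \<subseteq> topspace T \<and> T closure_of D = topspace T)"

definition borel_sets_of :: "'a topology \<Rightarrow> 'a set set" where
  "borel_sets_of T = sigma_sets (topspace T) {U. openin T U}"

definition borel_measure_on :: "'a topology \<Rightarrow> 'a measure \<Rightarrow> bool" where
  "borel_measure_on T M \<longleftrightarrow> space M = topspace T \<and> borel_sets_of T \<subseteq> sets M"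

definition borel_regular :: "'a topology \<Rightarrow> 'a measure \<Rightarrow> bool" where
  "borel_regular T M \<longleftrightarrow>
     (\<forall>A\<in>sets M. \<exists>B\<in>borel_sets_of T. A \<subseteq> B \<and> emeasure M A = emeasure M B)"

definition L0_functions :: "'a measure \<Rightarrow> ('a \<Rightarrow> ereal) set" where
  "L0_functions M = {f \<in> borel_measurable M. AE x in M. \<bar>f x\<bar> \<noteq> \<infinity>}"

definition ae_eq_rel :: "'a measure \<Rightarrow> (('a \<Rightarrow> ereal) \<times> ('a \<Rightarrow> ereal)) set" where
  "ae_eq_rel M = {(f, g). f \<in> L0_functions M \<and> g \<in> L0_functions M \<and> (AE x in M. f x = g x)}"

definition L0_space :: "'a measure \<Rightarrow> ('a \<Rightarrow> ereal) set set" where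
  "L0_space M = L0_functions M // ae_eq_rel M"

text \<open>At the points of the null set where the difference is infinite, the integrand has
  the irrelevant value \<open>0\<close>.\<close>

definition L0_fun_dist :: "'a measure \<Rightarrow> ('a \<Rightarrow> ereal) \<Rightarrow> ('a \<Rightarrow> ereal) \<Rightarrow> real" where
  "L0_fun_dist M f g = (LINT x|M. real_of_ereal (\<bar>f x - g x\<bar> / (1 + \<bar>f x - g x\<bar>)))"

text \<open>On equivalence classes; independent of the chosen representatives by
  \<open>L0_dist_eq\<close> below.\<close>

definition L0_dist :: "'a measure \<Rightarrow> ('a \<Rightarrow> ereal) set \<Rightarrow> ('a \<Rightarrow> ereal) set \<Rightarrow> real" where
  "L0_dist M U V = L0_fun_dist M (SOME f. f \<in> U) (SOME g. g \<in> V)"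

lemma equiv_ae_eq_rel: "equiv (L0_functions M) (ae_eq_rel M)"
proof (rule equivI)
  show "ae_eq_rel M \<subseteq> L0_functions M \<times> L0_functions M" "refl_on (L0_functions M) (ae_eq_rel M)"
    by (auto simp: ae_eq_rel_def refl_on_def)
  show "sym (ae_eq_rel M)"
    by (auto simp: ae_eq_rel_def sym_def eq_commute)
  show "trans (ae_eq_rel M)"
  proof (rule transI)
    fix f g h assume "(f, g) \<in> ae_eq_rel M" "(g, h) \<in> ae_eq_rel M"
    then show "(f, h) \<in> ae_eq_rel M"
      by (auto simp: ae_eq_rel_def elim: eventually_elim2)
  qed
qed

lemma L0_fun_dist_cong:
  assumes "(f, f') \<in> ae_eq_rel M" "(g, g') \<in> ae_eq_rel M"
  shows "L0_fun_dist M f g = L0_fun_dist M f' g'"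
proof -
  have [measurable]: "f \<in> borel_measurable M" "f' \<in> borel_measurable M"
    "g \<in> borel_measurable M" "g' \<in> borel_measurable M"
    and ae: "AE x in M. f x = f' x" "AE x in M. g x = g' x"
    using assms by (auto simp: ae_eq_rel_def L0_functions_def)
  show ?thesis
    unfolding L0_fun_dist_def
  proof (rule integral_cong_AE)
    show "AE x in M. real_of_ereal (\<bar>f x - g x\<bar> / (1 + \<bar>f x - g x\<bar>)) =
                     real_of_ereal (\<bar>f' x - g' x\<bar> / (1 + \<bar>f' x - g' x\<bar>))"
      using ae by eventually_elim simp
  qed measurable
qed

lemma L0_space_some:
  assumes "U \<in> L0_space M" shows "(SOME f. f \<in> U) \<in> U"
  using assms in_quotient_imp_non_empty[OF equiv_ae_eq_rel]
  unfolding L0_space_def by (metis some_in_eq)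

lemma L0_dist_eq:
  assumes "U \<in> L0_space M" "V \<in> L0_space M" "f \<in> U" "g \<in> V"
  shows "L0_dist M U V = L0_fun_dist M f g"
  unfolding L0_dist_def using assms L0_space_some[of U M] L0_space_some[of V M]
  by (intro L0_fun_dist_cong)
     (auto simp: L0_space_def intro: quotient_eq_iff[OF equiv_ae_eq_rel, THEN iffD1])

lemma L0_fun_dist_real:
  assumes "f \<in> L0_functions M" "g \<in> L0_functions M"
  shows "L0_fun_dist M f g = (LINT x|M. \<bar>real_of_ereal (f x) - real_of_ereal (g x)\<bar> /
           (1 + \<bar>real_of_ereal (f x) - real_of_ereal (g x)\<bar>))"
proof -
  have [measurable]: "f \<in> borel_measurable M" "g \<in> borel_measurable M"
    and ae: "AE x in M. \<bar>f x\<bar> \<noteq> \<infinity>" "AE x in M. \<bar>g x\<bar> \<noteq> \<infinity>"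
    using assms by (auto simp: L0_functions_def)
  show ?thesis
    unfolding L0_fun_dist_def
  proof (rule integral_cong_AE)
    show "AE x in M. real_of_ereal (\<bar>f x - g x\<bar> / (1 + \<bar>f x - g x\<bar>)) =
            \<bar>real_of_ereal (f x) - real_of_ereal (g x)\<bar> /
           (1 + \<bar>real_of_ereal (f x) - real_of_ereal (g x)\<bar>)"
      using ae
    proof eventually_elim
      case (elim x)
      then obtain a b where "f x = ereal a" "g x = ereal b" by auto
      then show ?case by (simp add: one_ereal_def)
    qed
  qed measurable
qed

lemma Metric_space_L0:
  assumes "finite_measure M"
  shows "Metric_space (L0_space M) (L0_dist M)"
proof
  interpret finite_measure M by fact
  let ?p = "\<lambda>f g x. \<bar>real_of_ereal (f x) - real_of_ereal (g x)\<bar> /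
           (1 + \<bar>real_of_ereal (f x) - real_of_ereal (g x)\<bar>)"
  have int: "integrable M (?p f g)" if "f \<in> L0_functions M" "g \<in> L0_functions M" for f g
  proof (rule integrable_const_bound[where B = 1])
    have [measurable]: "f \<in> borel_measurable M" "g \<in> borel_measurable M"
      using that by (auto simp: L0_functions_def)
    show "?p f g \<in> borel_measurable M" by measurable
    show "AE x in M. norm (?p f g x) \<le> 1" by (auto simp: divide_simps)
  qed
  have rep: "\<exists>f. f \<in> U \<and> f \<in> L0_functions M" if "U \<in> L0_space M" for U
    using that L0_space_some[OF that] in_quotient_imp_subset[OF equiv_ae_eq_rel]
    unfolding L0_space_def by blast
  fix U V W
  have "0 \<le> real_of_ereal (\<bar>a\<bar> / (1 + \<bar>a\<bar>))" for a :: ereal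
    by (cases a) (auto simp: one_ereal_def)
  then show "0 \<le> L0_dist M U V"
    by (simp add: L0_dist_def L0_fun_dist_def)
  have "\<bar>a - b\<bar> = \<bar>b - a\<bar>" for a b :: ereal
    by (cases a; cases b) auto
  then show "L0_dist M U V = L0_dist M V U"
    by (simp add: L0_dist_def L0_fun_dist_def)
  assume U: "U \<in> L0_space M" and V: "V \<in> L0_space M"
  obtain f g where f: "f \<in> U" "f \<in> L0_functions M" and g: "g \<in> V" "g \<in> L0_functions M"
    using rep U V by blast
  have "L0_dist M U V = 0 \<longleftrightarrow> (AE x in M. ?p f g x = 0)"
    using integral_nonneg_eq_0_iff_AE[OF int[OF f(2) g(2)]]
    by (simp add: L0_dist_eq[OF U V f(1) g(1)] L0_fun_dist_real[OF f(2) g(2)])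
  also have "\<dots> \<longleftrightarrow> (AE x in M. f x = g x)"
  proof -
    have "AE x in M. (?p f g x = 0) = (f x = g x)"
    proof -
      have "AE x in M. \<bar>f x\<bar> \<noteq> \<infinity>" "AE x in M. \<bar>g x\<bar> \<noteq> \<infinity>"
        using f g by (auto simp: L0_functions_def)
      then show ?thesis
      proof eventually_elim
        case (elim x)
        then obtain a b where "f x = ereal a" "g x = ereal b" by auto
        then show ?case by (simp add: add_nonneg_eq_0_iff)
      qed
    qed
    then show ?thesis
      by (rule eventually_subst)
  qed
  also have "\<dots> \<longleftrightarrow> U = V"
  proof -
    have "(U = V) = ((f, g) \<in> ae_eq_rel M)"
      using quotient_eq_iff[OF equiv_ae_eq_rel] U V f g by (metis L0_space_def)
    then show ?thesis using f g by (simp add: ae_eq_rel_def)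
  qed
  finally show "L0_dist M U V = 0 \<longleftrightarrow> U = V" .
  assume W: "W \<in> L0_space M"
  obtain h where h: "h \<in> W" "h \<in> L0_functions M"
    using rep W by blast
  have tri: "s / (1 + s) \<le> t / (1 + t) + r / (1 + r)"
    if "0 \<le> s" "0 \<le> t" "0 \<le> r" "s \<le> t + r" for s t r :: real
  proof -
    have "s / (1 + s) \<le> (t + r) / (1 + (t + r))"
      using that by (simp add: divide_simps) (simp add: algebra_simps)
    also have "\<dots> = t / (1 + (t + r)) + r / (1 + (t + r))"
      by (simp add: add_divide_distrib)
    also have "\<dots> \<le> t / (1 + t) + r / (1 + r)"
      using that by (intro add_mono divide_left_mono) auto
    finally show ?thesis .
  qed
  have "(LINT x|M. ?p f h x) \<le> (LINT x|M. ?p f g x + ?p g h x)"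
    by (intro integral_mono Bochner_Integration.integrable_add int f g h tri) auto
  also have "\<dots> = (LINT x|M. ?p f g x) + (LINT x|M. ?p g h x)"
    by (intro Bochner_Integration.integral_add int f g h)
  finally show "L0_dist M U W \<le> L0_dist M U V + L0_dist M V W"
    by (simp add: L0_dist_eq[OF U V f(1) g(1)] L0_dist_eq[OF U W f(1) h(1)]
      L0_dist_eq[OF V W g(1) h(1)] L0_fun_dist_real f g h)
qed

text \<open>Elements of \<open>F\<close> are equivalence classes, and the pointwise conditions are imposed on all
  of their representatives.  Asking for a single representative would be the same, because the
  (measurable) null set where two representatives differ can be absorbed into \<open>E\<close>.\<close>

definition uniformly_almost_equicontinuous_bounded ::
    "'a set \<Rightarrow> ('a \<Rightarrow> 'a \<Rightarrow> real) \<Rightarrow> 'a measure \<Rightarrow> ('a \<Rightarrow> ereal) set set \<Rightarrow> bool" where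
  "uniformly_almost_equicontinuous_bounded X d M F \<longleftrightarrow>
     (\<forall>\<epsilon>::real. \<epsilon> > 0 \<longrightarrow>
        (\<exists>\<delta>::real. \<delta> > 0 \<and> (\<exists>\<Lambda>::real. \<Lambda> > 0 \<and>
          (\<forall>U\<in>F. \<forall>u\<in>U. \<exists>E\<in>sets M.
             emeasure M E < ennreal \<epsilon> \<and>
             (\<forall>x\<in>X - E. \<forall>y\<in>X - E. d x y < \<delta> \<longrightarrow> \<bar>u x - u y\<bar> < ereal \<epsilon>) \<and>
             (\<forall>x\<in>X - E. \<bar>u x\<bar> \<le> ereal \<Lambda>)))))"

end

theory Submission
  imports Defs
begin

text \<open>
  Sufficiency is a pigeonhole argument.  Separability gives countably many open sets of small
  diameter that cover \<open>X\<close> (\<open>countable_open_cover_small\<close>), and as the measure is finite, finitely many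
  of them cover \<open>X\<close> up to small measure.  Off its exceptional set a member \<open>u\<close> of the family varies by
  less than \<open>\<epsilon>\<close> on each of these sets, so one sampled value per set, rounded to a multiple of \<open>\<epsilon>\<close>,
  determines \<open>u\<close> up to \<open>3 * \<epsilon>\<close> off a set of small measure.  Boundedness leaves only finitely many
  vectors of rounded values, and functions with equal vectors are close in \<open>L\<^sup>0\<close>.

  For necessity the point is that a single measurable function is uniformly continuous and bounded
  off a set of small measure.  A Lusin-type argument through disjoint closed sets would not give
  uniformity, because disjoint closed sets in a non-compact space can be at distance zero.
  Instead one considers the sets \<open>A\<close> such that, after removal of a set of small measure, the points of
  \<open>A\<close> stay a positive distance away from the points of the complement.  Such sets form a
  \<open>\<sigma>\<close>-algebra (\<open>almost_separated_compl\<close>, \<open>almost_separated_UN\<close>) that contains the open sets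
  (\<open>almost_separated_open\<close>); Borel regularity then puts every measurable set into it.  Applied to the
  finitely many level sets of a truncated function this gives the uniform continuity
  (\<open>almost_uniformly_continuous_bounded\<close>).  Finally, a totally bounded family lies near a finite net,
  and by Markov's inequality (\<open>measure_L0_far_le\<close>) closeness in \<open>L\<^sup>0\<close> means uniform closeness off a
  small set, so the constants of the finitely many net functions serve the whole family.
\<close>

section \<open>Quasi-metric topology\<close>

locale quasi_metric =
  fixes X :: "'a set" and d :: "'a \<Rightarrow> 'a \<Rightarrow> real" and C0 C1 :: real
  assumes nonempty: "X \<noteq> {}"
    and C0_pos: "C0 > 0" and C1_pos: "C1 > 0"
    and dist_self: "x \<in> X \<Longrightarrow> d x x = 0"
    and quasi_sym: "x \<in> X \<Longrightarrow> y \<in> X \<Longrightarrow> d y x \<le> C0 * d x y"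
    and quasi_triangle: "x \<in> X \<Longrightarrow> y \<in> X \<Longrightarrow> z \<in> X \<Longrightarrow> d x y \<le> C1 * max (d x z) (d z y)"
begin

lemma dist_less_via:
  assumes "x \<in> X" "y \<in> X" "z \<in> X" "d x z < r / C1" "d z y < r / C1"
  shows "d x y < r"
proof -
  have "max (d x z) (d z y) < r / C1"
    using assms by simp
  then have "C1 * max (d x z) (d z y) < r"
    using C1_pos by (simp only: pos_less_divide_eq mult.commute)
  then show ?thesis
    using quasi_triangle[OF assms(1-3)] by linarith
qed

lemma centre_in_qball: "x \<in> X \<Longrightarrow> 0 < r \<Longrightarrow> x \<in> qball X d x r"
  by (simp add: qball_def dist_self)

lemma qball_subset_of_nested:
  assumes "x \<in> X" "y \<in> qball X d x (r / C1)"
  shows "qball X d y (r / C1) \<subseteq> qball X d x r"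
  using assms dist_less_via[of x _ y r] by (auto simp: qball_def)

text \<open>
  Balls need not be open, but the points around which \<open>A\<close> contains a ball do form an open set:
  if the ball of radius \<open>s\<close> about \<open>y\<close> lies in \<open>A\<close>, the quasi-triangle inequality puts the ball of
  radius \<open>s / C1\<close> about any point of the ball of radius \<open>s / C1\<close> about \<open>y\<close> into \<open>A\<close> as well.  This
  lemma takes the place of the openness of balls.
\<close>

lemma qball_subset_interior:
  assumes "x \<in> X" "0 < r" "qball X d x r \<subseteq> A"
  shows "qball X d x (r / C1) \<subseteq> qtopology X d interior_of A"
proof -
  define I where "I = {y \<in> X. \<exists>s>0. qball X d y s \<subseteq> A}"
  have "\<exists>s>0. qball X d y s \<subseteq> I" if y_in: "y \<in> I" for y
  proof -
    obtain s where y: "y \<in> X" and s: "s > 0" "qball X d y s \<subseteq> A"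
      using y_in by (auto simp: I_def)
    have "qball X d y (s / C1) \<subseteq> I"
    proof
      fix z assume z: "z \<in> qball X d y (s / C1)"
      then have "qball X d z (s / C1) \<subseteq> A"
        using qball_subset_of_nested[OF y z] s by blast
      then show "z \<in> I"
        using z s C1_pos by (auto simp: I_def qball_def intro!: exI[of _ "s / C1"])
    qed
    then show ?thesis
      using s C1_pos by (intro exI[of _ "s / C1"]) auto
  qed
  then have "openin (qtopology X d) I"
    by (auto simp: openin_qtopology I_def)
  moreover have "I \<subseteq> A"
    using centre_in_qball by (auto simp: I_def)
  ultimately have "I \<subseteq> qtopology X d interior_of A"
    by (simp add: interior_of_maximal)
  moreover have "qball X d x (r / C1) \<subseteq> I"
  proof
    fix z assume z: "z \<in> qball X d x (r / C1)"
    then have "qball X d z (r / C1) \<subseteq> A"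
      using qball_subset_of_nested[OF assms(1) z] assms(3) by blast
    then show "z \<in> I"
      using z assms(2) C1_pos by (auto simp: I_def qball_def intro!: exI[of _ "r / C1"])
  qed
  ultimately show ?thesis by blast
qed

text \<open>
  The cover consists of the interiors of balls of one small radius about the points of a countable
  dense set.
\<close>

lemma countable_open_cover_small:
  assumes sep: "separable_topology (qtopology X d)" and r: "0 < r"
  obtains B :: "nat \<Rightarrow> 'a set" where
    "\<And>i. openin (qtopology X d) (B i)" "(\<Union>i. B i) = X"
    "\<And>i x y. x \<in> B i \<Longrightarrow> y \<in> B i \<Longrightarrow> d x y < r"
proof -
  obtain D where D: "countable D" "D \<subseteq> X" "qtopology X d closure_of D = X"
    using sep by (auto simp: separable_topology_def)
  have ne: "D \<noteq> {}"
    using D nonempty by auto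
  \<comment> \<open>Two points of a ball of radius \<open>s\<close> are compared through its centre \<open>z\<close>: \<open>d z y < s\<close> directly,
    but \<open>d x z < C0 * s\<close> only after reversing the arguments; hence the maximum.\<close>
  define s where "s = r / C1 / max C0 1"
  have s: "s > 0" using r C1_pos by (simp add: s_def)
  define B where "B i = qtopology X d interior_of (qball X d (from_nat_into D i) s)" for i
  have cen: "from_nat_into D i \<in> X" for i
    using from_nat_into[OF ne] D by blast
  have sub: "B i \<subseteq> qball X d (from_nat_into D i) s" for i
    by (simp add: B_def interior_of_subset)
  have small: "d x y < r" if "x \<in> B i" "y \<in> B i" for i x y
  proof -
    let ?z = "from_nat_into D i"
    have x: "x \<in> X" "d ?z x < s" and y: "y \<in> X" "d ?z y < s"
      using sub[of i] that by (auto simp: qball_def)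
    have "d x ?z \<le> C0 * d ?z x"
      using quasi_sym x cen by blast
    also have "\<dots> < C0 * s"
      using x C0_pos by simp
    also have "\<dots> \<le> max C0 1 * s"
      using s by (intro mult_right_mono) auto
    also have "\<dots> = r / C1"
      by (simp add: s_def)
    finally have 1: "d x ?z < r / C1" .
    have "1 * s \<le> max C0 1 * s"
      using s by (intro mult_right_mono) auto
    also have "\<dots> = r / C1"
      by (simp add: s_def)
    finally have "d ?z y < r / C1"
      using y by simp
    with 1 show ?thesis
      using dist_less_via x y cen by blast
  qed
  have cover: "x \<in> (\<Union>i. B i)" if x: "x \<in> X" for x
  proof -
    \<comment> \<open>Density yields a centre \<open>z\<close> in a ball about \<open>x\<close>, while \<open>x\<close> must lie in a ball about \<open>z\<close>: the
      factor \<open>C0\<close> pays for the reversal, the factor \<open>C1\<close> for passing to the interior.\<close>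
    define t where "t = s / C1 / C0"
    have t: "t > 0"
      using s C0_pos C1_pos by (simp add: t_def)
    define N where "N = qtopology X d interior_of (qball X d x t)"
    have "x \<in> N"
      using qball_subset_interior[OF x t order_refl] centre_in_qball[OF x, of "t / C1"] t C1_pos
      by (auto simp: N_def)
    moreover have "openin (qtopology X d) N"
      by (simp add: N_def)
    moreover have "x \<in> qtopology X d closure_of D"
      using D(3) x by simp
    ultimately obtain z where z: "z \<in> D" "z \<in> N"
      unfolding in_closure_of by blast
    then have "d x z < t" and zX: "z \<in> X"
      using interior_of_subset[of "qtopology X d" "qball X d x t"] by (auto simp: N_def qball_def)
    then have "C0 * d x z < C0 * t"
      using C0_pos by simp
    also have "\<dots> = s / C1"
      using C0_pos by (simp add: t_def)
    finally have "C0 * d x z < s / C1" .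
    with quasi_sym[OF x zX] have "x \<in> qball X d z (s / C1)"
      using x by (simp add: qball_def)
    moreover obtain i where "from_nat_into D i = z"
      using from_nat_into_surj[OF D(1) z(1)] by blast
    ultimately show ?thesis
      using qball_subset_interior[OF zX s order_refl] by (auto simp: B_def)
  qed
  have op: "openin (qtopology X d) (B i)" for i
    by (simp add: B_def)
  have "(\<Union>i. B i) = X"
    using cover openin_subset[OF op] by auto
  with op small show thesis
    using that by blast
qed

end

section \<open>Measure and metric preliminaries\<close>

lemma (in finite_measure) exhaustion_small_remainder:
  fixes A :: "nat \<Rightarrow> 'a set"
  assumes A: "\<And>i. A i \<in> sets M" and "0 < e"
  obtains n where "measure M ((\<Union>i. A i) - (\<Union>i<n. A i)) < e"
proof -
  let ?R = "\<lambda>n. (\<Union>i. A i) - (\<Union>i<n. A i)"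
  have "(\<lambda>n. measure M (?R n)) \<longlonglongrightarrow> measure M (\<Inter>n. ?R n)"
    using A by (intro finite_Lim_measure_decseq) (auto simp: decseq_def)
  moreover have "(\<Inter>n. ?R n) = {}"
    by blast
  ultimately have "(\<lambda>n. measure M (?R n)) \<longlonglongrightarrow> 0"
    by (simp only: measure_empty)
  then have "eventually (\<lambda>n. measure M (?R n) < e) sequentially"
    using order_tendstoD(2) \<open>0 < e\<close> by blast
  then show thesis
    using that by (auto simp: eventually_sequentially)
qed

text \<open>
  A net consisting of points of \<open>S\<close> itself is obtained by choosing one point for each code, so that
  no approximating objects outside \<open>S\<close> have to be constructed.
\<close>

lemma (in Metric_space) mtotally_bounded_if_finite_codes:
  assumes "S \<subseteq> M"
    and code: "\<And>e. 0 < e \<Longrightarrow> \<exists>\<kappa> :: 'a \<Rightarrow> 'c. finite (\<kappa> ` S) \<and>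
                 (\<forall>x\<in>S. \<forall>y\<in>S. \<kappa> x = \<kappa> y \<longrightarrow> d x y < e)"
  shows "mtotally_bounded S"
  unfolding mtotally_bounded_def
proof (intro allI impI)
  fix e :: real assume "0 < e"
  then obtain \<kappa> :: "'a \<Rightarrow> 'c" where \<kappa>: "finite (\<kappa> ` S)"
    "\<And>x y. x \<in> S \<Longrightarrow> y \<in> S \<Longrightarrow> \<kappa> x = \<kappa> y \<Longrightarrow> d x y < e"
    using code by blast
  define K where "K = inv_into S \<kappa> ` \<kappa> ` S"
  have "finite K" "K \<subseteq> S"
    using \<kappa>(1) by (auto simp: K_def inv_into_into)
  moreover have "x \<in> (\<Union>k\<in>K. mball k e)" if x: "x \<in> S" for x
  proof -
    let ?k = "inv_into S \<kappa> (\<kappa> x)"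
    have "?k \<in> S" "\<kappa> ?k = \<kappa> x"
      using x by (auto simp: inv_into_into f_inv_into_f)
    then have "x \<in> mball ?k e"
      using x \<kappa>(2)[of ?k x] \<open>S \<subseteq> M\<close> by (auto simp: mball_def)
    then show ?thesis
      using x by (auto simp: K_def)
  qed
  ultimately show "\<exists>K. finite K \<and> K \<subseteq> S \<and> S \<subseteq> (\<Union>x\<in>K. mball x e)"
    by blast
qed

lemma finite_pos_lower_bound:
  fixes f :: "'b \<Rightarrow> real"
  assumes "finite I" "\<And>i. i \<in> I \<Longrightarrow> 0 < f i"
  obtains c where "0 < c" "\<And>i. i \<in> I \<Longrightarrow> c \<le> f i"
proof
  show "0 < Min (insert 1 (f ` I))"
    using assms by (subst Min_gr_iff) auto
  show "Min (insert 1 (f ` I)) \<le> f i" if "i \<in> I" for i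
    using assms that by (intro Min_le) auto
qed

lemma abs_diff_less_if_floor_eq:
  fixes a b e :: real
  assumes "0 < e" "\<lfloor>a / e\<rfloor> = \<lfloor>b / e\<rfloor>"
  shows "\<bar>a - b\<bar> < e"
proof -
  have "\<bar>a / e - b / e\<bar> < 1"
    using assms(2) by linarith
  then have "\<bar>(a - b) / e\<bar> < 1"
    by (simp add: diff_divide_distrib)
  then show ?thesis
    using assms(1) by (simp add: abs_divide)
qed

section \<open>The distance of convergence in measure\<close>

lemma L0_functionsD:
  assumes "f \<in> L0_functions M"
  shows "f \<in> borel_measurable M" "AE x in M. \<bar>f x\<bar> \<noteq> \<infinity>"
  using assms by (auto simp: L0_functions_def)

lemma L0_space_representative:
  assumes "U \<in> L0_space M" "u \<in> U"
  shows "u \<in> L0_functions M"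
  using assms in_quotient_imp_subset[OF equiv_ae_eq_rel] unfolding L0_space_def by blast

lemma real_diff_quotient_le_1: "\<bar>a - b\<bar> / (1 + \<bar>a - b\<bar>) \<le> (1::real)"
  by (simp add: divide_simps)

lemma (in finite_measure) integrable_L0_integrand:
  assumes "f \<in> L0_functions M" "g \<in> L0_functions M"
  shows "integrable M (\<lambda>x. \<bar>real_of_ereal (f x) - real_of_ereal (g x)\<bar> /
           (1 + \<bar>real_of_ereal (f x) - real_of_ereal (g x)\<bar>))"
proof (rule integrable_const_bound[where B = 1])
  have [measurable]: "f \<in> borel_measurable M" "g \<in> borel_measurable M"
    using assms by (auto dest: L0_functionsD)
  show "(\<lambda>x. \<bar>real_of_ereal (f x) - real_of_ereal (g x)\<bar> /
           (1 + \<bar>real_of_ereal (f x) - real_of_ereal (g x)\<bar>)) \<in> borel_measurable M"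
    by measurable
qed (auto simp: divide_simps)

text \<open>
  This lemma and the next express that \<open>L\<^sup>0\<close> convergence is convergence in measure.  The integrand
  \<open>\<bar>f - g\<bar> / (1 + \<bar>f - g\<bar>)\<close> never exceeds \<open>\<bar>f - g\<bar>\<close>, which is used off \<open>E\<close>, nor \<open>1\<close>, which is used on \<open>E\<close>.
\<close>

lemma (in finite_measure) L0_fun_dist_le:
  assumes f: "f \<in> L0_functions M" and g: "g \<in> L0_functions M" and E: "E \<in> sets M"
    and close: "\<And>x. x \<in> space M - E \<Longrightarrow> \<bar>real_of_ereal (f x) - real_of_ereal (g x)\<bar> \<le> c"
    and "0 \<le> c"
  shows "L0_fun_dist M f g \<le> c * measure M (space M) + measure M E"
proof -
  let ?p = "\<lambda>x. \<bar>real_of_ereal (f x) - real_of_ereal (g x)\<bar> /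
           (1 + \<bar>real_of_ereal (f x) - real_of_ereal (g x)\<bar>)"
  have le: "?p x \<le> c + indicator E x" if x: "x \<in> space M" for x
  proof (cases "x \<in> E")
    case True
    then show ?thesis
      using real_diff_quotient_le_1[of "real_of_ereal (f x)" "real_of_ereal (g x)"] \<open>0 \<le> c\<close>
      by (simp add: add_increasing)
  next
    case False
    have "?p x \<le> \<bar>real_of_ereal (f x) - real_of_ereal (g x)\<bar> / 1"
      by (intro divide_left_mono) auto
    then show ?thesis
      using False close[of x] x by simp
  qed
  have int: "integrable M (indicator E :: 'a \<Rightarrow> real)"
    using E by (simp add: integrable_indicator_iff less_top[symmetric] emeasure_eq_measure)
  have "L0_fun_dist M f g = (LINT x|M. ?p x)"
    by (rule L0_fun_dist_real[OF f g])
  also have "\<dots> \<le> (LINT x|M. c + indicator E x)"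
    using int by (intro integral_mono integrable_L0_integrand f g Bochner_Integration.integrable_add le) auto
  also have "\<dots> = c * measure M (space M) + measure M E"
    using int E by (subst Bochner_Integration.integral_add) (auto simp: mult.commute)
  finally show ?thesis .
qed

text \<open>
  Markov's inequality for the integrand: as \<open>h / (1 + h)\<close> increases in \<open>h\<close>, it is at least
  \<open>t / (1 + t)\<close> wherever \<open>\<bar>f - g\<bar> \<ge> t\<close>.
\<close>

lemma (in finite_measure) measure_L0_far_le:
  assumes f: "f \<in> L0_functions M" and g: "g \<in> L0_functions M" and t: "0 < t"
  shows "measure M {x \<in> space M. t \<le> \<bar>real_of_ereal (f x) - real_of_ereal (g x)\<bar>}
           \<le> L0_fun_dist M f g * ((1 + t) / t)"
proof -
  have [measurable]: "f \<in> borel_measurable M" "g \<in> borel_measurable M"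
    using f g by (auto dest: L0_functionsD)
  let ?h = "\<lambda>x. \<bar>real_of_ereal (f x) - real_of_ereal (g x)\<bar>"
  let ?A = "{x \<in> space M. t \<le> ?h x}"
  have A: "?A \<in> sets M"
    by measurable
  have int: "integrable M (indicator ?A :: 'a \<Rightarrow> real)"
    using A by (simp add: integrable_indicator_iff less_top[symmetric] emeasure_eq_measure)
  have mono: "t / (1 + t) \<le> h / (1 + h)" if "t \<le> h" for h
    using t that by (simp add: divide_simps) (simp add: algebra_simps)
  have le: "t / (1 + t) * indicator ?A x \<le> ?h x / (1 + ?h x)" for x
    using mono[of "?h x"] by (auto simp: indicator_def)
  have "t / (1 + t) * measure M ?A = (LINT x|M. t / (1 + t) * indicator ?A x)"
    using A by simp
  also have "\<dots> \<le> (LINT x|M. ?h x / (1 + ?h x))"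
    using int by (intro integral_mono integrable_L0_integrand f g integrable_mult_right le) auto
  also have "\<dots> = L0_fun_dist M f g"
    by (simp add: L0_fun_dist_real[OF f g])
  finally show ?thesis
    using t by (simp add: field_simps)
qed

section \<open>Sufficiency\<close>

locale finite_quasi_metric_measure = quasi_metric X d C0 C1 + finite_measure M
  for X :: "'a set" and d C0 C1 and M :: "'a measure" +
  assumes space_eq: "space M = X"
    and open_in_sets: "openin (qtopology X d) U \<Longrightarrow> U \<in> sets M"
begin

text \<open>
  The code of a class is the vector of the rounded sample values of a representative.  If two
  representatives have the same code, then at a point of the \<open>i\<close>-th covering set, off both
  exceptional sets, they differ by at most the two oscillations plus the difference of the sample
  values, each below \<open>\<epsilon>\<close>.  The sample points of the two functions may differ.
\<close>

lemma mtotally_bounded_if_equicontinuous: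
  assumes sep: "separable_topology (qtopology X d)"
    and F: "F \<subseteq> L0_space M"
    and cond: "uniformly_almost_equicontinuous_bounded X d M F"
  shows "Metric_space.mtotally_bounded (L0_space M) (L0_dist M) F"
proof -
  interpret L0: Metric_space "L0_space M" "L0_dist M"
    by (rule Metric_space_L0) unfold_locales
  show ?thesis
  proof (rule L0.mtotally_bounded_if_finite_codes[OF F])
    fix e :: real assume e: "0 < e"
    define m where "m = measure M (space M)"
    \<comment> \<open>The distance will be bounded by \<open>3 * \<epsilon> * m\<close> from the points where the functions are close and
      \<open>3 * \<epsilon>\<close> from the three discarded sets; this choice makes the sum \<open>e / 2\<close>.\<close>
    define \<epsilon> where "\<epsilon> = e / (6 * (m + 1))"
    have m: "m \<ge> 0" by (simp add: m_def)
    then have \<epsilon>: "\<epsilon> > 0" using e by (simp add: \<epsilon>_def)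
    have \<epsilon>_total: "3 * \<epsilon> * m + 3 * \<epsilon> < e"
    proof -
      have "3 * \<epsilon> * m + 3 * \<epsilon> = \<epsilon> * (6 * (m + 1)) / 2"
        by (simp add: algebra_simps)
      also have "\<dots> = e / 2"
        using m by (simp add: \<epsilon>_def)
      finally show ?thesis using e by simp
    qed
    obtain \<delta> \<Lambda> where \<delta>: "\<delta> > 0" and \<Lambda>: "\<Lambda> > 0"
      and ex: "\<forall>U\<in>F. \<forall>u\<in>U. \<exists>E\<in>sets M.
             emeasure M E < ennreal \<epsilon> \<and>
             (\<forall>x\<in>X - E. \<forall>y\<in>X - E. d x y < \<delta> \<longrightarrow> \<bar>u x - u y\<bar> < ereal \<epsilon>) \<and>
             (\<forall>x\<in>X - E. \<bar>u x\<bar> \<le> ereal \<Lambda>)"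
      using cond[unfolded uniformly_almost_equicontinuous_bounded_def, rule_format, OF \<epsilon>]
      by (elim exE conjE) (rule that)
    define rep :: "('a \<Rightarrow> ereal) set \<Rightarrow> 'a \<Rightarrow> ereal" where "rep U = (SOME u. u \<in> U)" for U
    define v where "v U x = real_of_ereal (rep U x)" for U x
    have rep: "rep U \<in> U" "rep U \<in> L0_functions M" if "U \<in> F" for U
      using L0_space_some[of U M] L0_space_representative[of U M] F that by (auto simp: rep_def)
    have "\<forall>U\<in>F. \<exists>E\<in>sets M.
             emeasure M E < ennreal \<epsilon> \<and>
             (\<forall>x\<in>X - E. \<forall>y\<in>X - E. d x y < \<delta> \<longrightarrow> \<bar>rep U x - rep U y\<bar> < ereal \<epsilon>) \<and>
             (\<forall>x\<in>X - E. \<bar>rep U x\<bar> \<le> ereal \<Lambda>)"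
      using ex rep(1) by blast
    from bchoice[OF this[unfolded Bex_def]] obtain E where E: "\<And>U. U \<in> F \<Longrightarrow> E U \<in> sets M"
      "\<And>U. U \<in> F \<Longrightarrow> emeasure M (E U) < ennreal \<epsilon>"
      and osc: "\<And>U x y. U \<in> F \<Longrightarrow> x \<in> X - E U \<Longrightarrow> y \<in> X - E U \<Longrightarrow> d x y < \<delta> \<Longrightarrow>
             \<bar>rep U x - rep U y\<bar> < ereal \<epsilon>"
      and bnd: "\<And>U x. U \<in> F \<Longrightarrow> x \<in> X - E U \<Longrightarrow> \<bar>rep U x\<bar> \<le> ereal \<Lambda>"
      by blast
    have E_small: "measure M (E U) < \<epsilon>" if "U \<in> F" for U
      using E(2)[OF that] \<epsilon> by (simp add: emeasure_eq_measure ennreal_less_iff)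
    have v: "rep U x = ereal (v U x)" if "U \<in> F" "x \<in> X - E U" for U x
      using bnd[OF that] by (cases "rep U x") (auto simp: v_def)
    have v_bnd: "\<bar>v U x\<bar> \<le> \<Lambda>" if "U \<in> F" "x \<in> X - E U" for U x
      using bnd[OF that] v[OF that] by simp
    have v_osc: "\<bar>v U x - v U y\<bar> < \<epsilon>"
      if "U \<in> F" "x \<in> X - E U" "y \<in> X - E U" "d x y < \<delta>" for U x y
      using osc[OF that] v that by simp
    obtain B :: "nat \<Rightarrow> 'a set" where B: "\<And>i. openin (qtopology X d) (B i)" "(\<Union>i. B i) = X"
      "\<And>i x y. x \<in> B i \<Longrightarrow> y \<in> B i \<Longrightarrow> d x y < \<delta>"
      using countable_open_cover_small[OF sep \<delta>] by blast
    have B_sets: "B i \<in> sets M" for i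
      by (rule open_in_sets[OF B(1)])
    obtain n where n: "measure M ((\<Union>i. B i) - (\<Union>i<n. B i)) < \<epsilon>"
      using exhaustion_small_remainder[of B, OF B_sets \<epsilon>] by blast
    define R where "R = X - (\<Union>i<n. B i)"
    have R: "R \<in> sets M" "measure M R < \<epsilon>"
      using n B(2) B_sets space_eq by (auto simp: R_def)
    define pt where "pt U i = (SOME x. x \<in> B i - E U)" for U i
    \<comment> \<open>A covering set swallowed by the exceptional set has no sample point; its entry \<open>0\<close> is never
      consulted, because every point compared below lies off the exceptional sets.\<close>
    define \<kappa> where "\<kappa> U = (\<lambda>i\<in>{..<n}. if B i \<subseteq> E U then 0 else \<lfloor>v U (pt U i) / \<epsilon>\<rfloor>)" for U
    have BX: "B i \<subseteq> X" for i
      using B(2) by blast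
    have pt: "pt U i \<in> B i" "pt U i \<in> X - E U" if "\<not> B i \<subseteq> E U" for U i
    proof -
      have "\<exists>x. x \<in> B i - E U" using that by blast
      then have "pt U i \<in> B i - E U" unfolding pt_def by (rule someI_ex)
      then show "pt U i \<in> B i" "pt U i \<in> X - E U" using BX by auto
    qed
    have "\<kappa> ` F \<subseteq> {..<n} \<rightarrow>\<^sub>E {\<lfloor>- \<Lambda> / \<epsilon>\<rfloor>..\<lfloor>\<Lambda> / \<epsilon>\<rfloor>}"
    proof -
      have fl: "\<lfloor>- \<Lambda> / \<epsilon>\<rfloor> \<le> \<lfloor>v U (pt U i) / \<epsilon>\<rfloor> \<and> \<lfloor>v U (pt U i) / \<epsilon>\<rfloor> \<le> \<lfloor>\<Lambda> / \<epsilon>\<rfloor>"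
        if "U \<in> F" "\<not> B i \<subseteq> E U" for U i
        using v_bnd[OF that(1) pt(2)[OF that(2)]] \<epsilon>
        by (intro conjI floor_mono divide_right_mono) auto
      have fl0: "\<lfloor>- \<Lambda> / \<epsilon>\<rfloor> \<le> 0" "0 \<le> \<lfloor>\<Lambda> / \<epsilon>\<rfloor>"
        using divide_pos_pos[OF \<Lambda> \<epsilon>] by (simp_all add: floor_le_zero zero_le_floor)
      have rng: "\<kappa> U i \<in> {\<lfloor>- \<Lambda> / \<epsilon>\<rfloor>..\<lfloor>\<Lambda> / \<epsilon>\<rfloor>}" if "U \<in> F" "i < n" for U i
      proof (cases "B i \<subseteq> E U")
        case True
        then have "\<kappa> U i = 0" using that by (simp add: \<kappa>_def)
        then show ?thesis using fl0 by (simp only: atLeastAtMost_iff)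
      next
        case False
        then have "\<kappa> U i = \<lfloor>v U (pt U i) / \<epsilon>\<rfloor>" using that by (simp add: \<kappa>_def)
        then show ?thesis using fl[OF that(1) False] by (simp only: atLeastAtMost_iff)
      qed
      show ?thesis
      proof (intro image_subsetI PiE_I)
        fix U i assume "U \<in> F" "i \<in> {..<n}"
        then show "\<kappa> U i \<in> {\<lfloor>- \<Lambda> / \<epsilon>\<rfloor>..\<lfloor>\<Lambda> / \<epsilon>\<rfloor>}" using rng by blast
      next
        fix U i assume "i \<notin> {..<n}"
        then show "\<kappa> U i = undefined" by (simp add: \<kappa>_def)
      qed
    qed
    then have "finite (\<kappa> ` F)"
      by (rule finite_subset) (intro finite_PiE finite_lessThan finite_atLeastAtMost_int)
    moreover have "L0_dist M U V < e" if U: "U \<in> F" and V: "V \<in> F" and eq: "\<kappa> U = \<kappa> V" for U V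
    proof -
      let ?E = "E U \<union> E V \<union> R"
      have near: "\<bar>v U x - v V x\<bar> \<le> 3 * \<epsilon>" if x: "x \<in> space M - ?E" for x
      proof -
        have xU: "x \<in> X - E U" and xV: "x \<in> X - E V"
          using x space_eq by auto
        obtain i where i: "i < n" "x \<in> B i"
          using x space_eq by (auto simp: R_def)
        then have nU: "\<not> B i \<subseteq> E U" and nV: "\<not> B i \<subseteq> E V"
          using xU xV by auto
        have "\<lfloor>v U (pt U i) / \<epsilon>\<rfloor> = \<lfloor>v V (pt V i) / \<epsilon>\<rfloor>"
          using fun_cong[OF eq, of i] i nU nV by (simp add: \<kappa>_def)
        then have "\<bar>v U (pt U i) - v V (pt V i)\<bar> < \<epsilon>"
          by (rule abs_diff_less_if_floor_eq[OF \<epsilon>])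
        moreover have "\<bar>v U x - v U (pt U i)\<bar> < \<epsilon>"
          by (rule v_osc[OF U xU pt(2)[OF nU] B(3)[OF i(2) pt(1)[OF nU]]])
        moreover have "\<bar>v V x - v V (pt V i)\<bar> < \<epsilon>"
          by (rule v_osc[OF V xV pt(2)[OF nV] B(3)[OF i(2) pt(1)[OF nV]]])
        ultimately show ?thesis by linarith
      qed
      have sets: "E U \<union> E V \<in> sets M" "?E \<in> sets M"
        using E(1)[OF U] E(1)[OF V] R(1) by auto
      have "L0_fun_dist M (rep U) (rep V) \<le> 3 * \<epsilon> * m + measure M ?E"
        unfolding m_def
      proof (rule L0_fun_dist_le[OF rep(2)[OF U] rep(2)[OF V] sets(2)])
        show "0 \<le> 3 * \<epsilon>" using \<epsilon> by simp
        show "\<bar>real_of_ereal (rep U x) - real_of_ereal (rep V x)\<bar> \<le> 3 * \<epsilon>"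
          if "x \<in> space M - ?E" for x
          using near[OF that] by (simp only: v_def)
      qed
      also have "measure M ?E \<le> measure M (E U) + measure M (E V) + measure M R"
        using measure_Un_le[OF sets(1) R(1)]
          measure_Un_le[OF E(1)[OF U] E(1)[OF V]] by linarith
      also have "\<dots> < 3 * \<epsilon>"
        using E_small[OF U] E_small[OF V] R(2) by linarith
      finally have "L0_fun_dist M (rep U) (rep V) < e"
        using \<epsilon>_total by linarith
      then show ?thesis
        using L0_dist_eq[OF _ _ rep(1)[OF U] rep(1)[OF V]] U V F by (simp add: subset_iff)
    qed
    ultimately show "\<exists>\<kappa> :: ('a \<Rightarrow> ereal) set \<Rightarrow> nat \<Rightarrow> int. finite (\<kappa> ` F) \<and>
        (\<forall>U\<in>F. \<forall>V\<in>F. \<kappa> U = \<kappa> V \<longrightarrow> L0_dist M U V < e)"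
      by blast
  qed
qed

section \<open>Sets at positive distance from their complement\<close>

definition separated_off :: "'a set \<Rightarrow> real \<Rightarrow> 'a set \<Rightarrow> bool" where
  "separated_off E \<delta> A \<longleftrightarrow> (\<forall>x\<in>A - E. \<forall>y\<in>X - A - E. \<delta> \<le> d x y)"

definition almost_separated :: "'a set \<Rightarrow> bool" where
  "almost_separated A \<longleftrightarrow>
     A \<in> sets M \<and> (\<forall>e>0. \<exists>E\<in>sets M. \<exists>\<delta>>0. measure M E < e \<and> separated_off E \<delta> A)"

lemma separated_off_mono:
  "separated_off E \<delta> A \<Longrightarrow> E \<subseteq> E' \<Longrightarrow> \<delta>' \<le> \<delta> \<Longrightarrow> separated_off E' \<delta>' A"
  unfolding separated_off_def by (meson DiffD1 DiffD2 DiffI order_trans subsetD)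

text \<open>
  Finitely many sets can share one exceptional set and one distance: take the union of the
  exceptional sets, splitting \<open>e\<close> among them, and the least of the distances.
\<close>

lemma almost_separated_simultaneous:
  assumes "finite I" "\<And>i. i \<in> I \<Longrightarrow> almost_separated (A i)" "0 < e"
  shows "\<exists>E\<in>sets M. \<exists>\<delta>>0. measure M E < e \<and> (\<forall>i\<in>I. separated_off E \<delta> (A i))"
  using assms
proof (induction I arbitrary: e rule: finite_induct)
  case empty
  then show ?case by (intro bexI[of _ "{}"] exI[of _ 1]) auto
next
  case (insert j I)
  obtain E \<delta> where E: "E \<in> sets M" "\<delta> > 0" "measure M E < e / 2"
    "\<forall>i\<in>I. separated_off E \<delta> (A i)"
    using insert.IH[of "e / 2"] insert.prems by auto
  obtain E' \<delta>' where E': "E' \<in> sets M" "\<delta>' > 0" "measure M E' < e / 2" "separated_off E' \<delta>' (A j)"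
    using insert.prems unfolding almost_separated_def by (meson half_gt_zero insertI1)
  have "measure M (E \<union> E') < e"
    using measure_Un_le[OF E(1) E'(1)] E(3) E'(3) by linarith
  moreover have "\<forall>i\<in>insert j I. separated_off (E \<union> E') (min \<delta> \<delta>') (A i)"
    using E(4) E'(4) by (auto intro: separated_off_mono)
  ultimately show ?case
    using E E' by (intro bexI[of _ "E \<union> E'"] exI[of _ "min \<delta> \<delta>'"]) auto
qed

text \<open>
  The points of \<open>U\<close> whose ball of radius \<open>1 / (n + 1)\<close> stays inside \<open>U\<close> are at least that far from the
  complement, and as \<open>n\<close> grows they exhaust \<open>U\<close>.  These sets need not be measurable, so they are
  replaced by their interiors, which still exhaust \<open>U\<close>.
\<close>

lemma almost_separated_open:
  assumes "openin (qtopology X d) U"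
  shows "almost_separated U"
  unfolding almost_separated_def
proof (intro conjI allI impI)
  show U: "U \<in> sets M"
    by (rule open_in_sets[OF assms])
  fix e :: real assume e: "0 < e"
  define W where "W n = {x \<in> U. qball X d x (1 / Suc n) \<subseteq> U}" for n
  define I where "I n = qtopology X d interior_of (W n)" for n
  have UX: "U \<subseteq> X"
    using assms by (simp add: openin_qtopology)
  have IW: "I n \<subseteq> W n" for n
    by (simp add: I_def interior_of_subset)
  have I_sets: "I n \<in> sets M" for n
    by (simp add: I_def open_in_sets)
  have "x \<in> (\<Union>n. I n)" if x: "x \<in> U" for x
  proof -
    have xX: "x \<in> X" using x UX by blast
    obtain r where r: "r > 0" "qball X d x r \<subseteq> U"
      using assms x unfolding openin_qtopology by blast
    define s where "s = r / C1"
    have s: "s > 0" using r C1_pos by (simp add: s_def)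
    obtain n where n: "1 / real (Suc n) < s"
      using nat_approx_posE[OF s] by blast
    have "qball X d x s \<subseteq> W n"
    proof
      fix y assume y: "y \<in> qball X d x s"
      have yX: "y \<in> X" using y by (simp add: qball_def)
      have sub: "qball X d y s \<subseteq> U"
        using qball_subset_of_nested[OF xX, of y r] y r by (auto simp: s_def)
      then have "y \<in> U"
        using centre_in_qball[OF yX s] by blast
      moreover have "qball X d y (1 / Suc n) \<subseteq> qball X d y s"
        using n by (auto simp: qball_def)
      ultimately show "y \<in> W n"
        using sub by (auto simp: W_def)
    qed
    from qball_subset_interior[OF xX s this] have "qball X d x (s / C1) \<subseteq> I n"
      by (simp add: I_def)
    moreover have "x \<in> qball X d x (s / C1)"
      using centre_in_qball[OF xX] s C1_pos by simp
    ultimately show ?thesis by blast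
  qed
  then have UI: "(\<Union>n. I n) = U"
    using IW by (auto simp: W_def)
  obtain n where n: "measure M ((\<Union>n. I n) - (\<Union>k<n. I k)) < e"
    using exhaustion_small_remainder[of I, OF I_sets e] by blast
  define E where "E = U - (\<Union>k<n. I k)"
  have "E \<in> sets M" "measure M E < e"
    using n UI U I_sets by (auto simp: E_def)
  moreover have "separated_off E (1 / Suc n) U"
    unfolding separated_off_def
  proof (intro ballI)
    fix x y assume x: "x \<in> U - E" and y: "y \<in> X - U - E"
    obtain k where k: "k < n" "x \<in> I k"
      using x by (auto simp: E_def)
    have "y \<notin> qball X d x (1 / Suc k)"
      using IW[of k] k y by (auto simp: W_def)
    then have "1 / Suc k \<le> d x y"
      using y by (simp add: qball_def)
    moreover have "1 / real (Suc n) \<le> 1 / real (Suc k)"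
      using k by (intro divide_left_mono) auto
    ultimately show "1 / Suc n \<le> d x y" by linarith
  qed
  ultimately show "\<exists>E\<in>sets M. \<exists>\<delta>>0. measure M E < e \<and> separated_off E \<delta> U"
    by (intro bexI[of _ E] exI[of _ "1 / Suc n"]) auto
qed

text \<open>
  The definition asks for a lower bound on distances measured from the set to its complement only;
  the reversed distances differ by at most the factor \<open>C0\<close>.
\<close>

lemma almost_separated_compl:
  assumes "almost_separated A"
  shows "almost_separated (X - A)"
  unfolding almost_separated_def
proof (intro conjI allI impI)
  have A: "A \<in> sets M" using assms by (simp add: almost_separated_def)
  then show "X - A \<in> sets M" using space_eq by auto
  fix e :: real assume "0 < e"
  then obtain E \<delta> where E: "E \<in> sets M" "\<delta> > 0" "measure M E < e" "separated_off E \<delta> A"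
    using assms unfolding almost_separated_def by meson
  have "separated_off E (\<delta> / C0) (X - A)"
    unfolding separated_off_def
  proof (intro ballI)
    fix x y assume x: "x \<in> X - A - E" and y: "y \<in> X - (X - A) - E"
    then have "\<delta> \<le> d y x"
      using E(4) by (auto simp: separated_off_def)
    also have "\<dots> \<le> C0 * d x y"
      using x y by (intro quasi_sym) auto
    finally show "\<delta> / C0 \<le> d x y"
      using C0_pos by (simp add: field_simps)
  qed
  then show "\<exists>E\<in>sets M. \<exists>\<delta>>0. measure M E < e \<and> separated_off E \<delta> (X - A)"
    using E C0_pos by (intro bexI[of _ E] exI[of _ "\<delta> / C0"]) auto
qed

text \<open>
  Up to a set of small measure the union is a union of finitely many of the sets.  A point outside
  the whole union is outside each of these, hence far from it.
\<close>

lemma almost_separated_UN: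
  fixes A :: "nat \<Rightarrow> 'a set"
  assumes "\<And>i. almost_separated (A i)"
  shows "almost_separated (\<Union>i. A i)"
  unfolding almost_separated_def
proof (intro conjI allI impI)
  have A: "A i \<in> sets M" for i
    using assms by (simp add: almost_separated_def)
  then show "(\<Union>i. A i) \<in> sets M" by blast
  fix e :: real assume "0 < e"
  then have e: "0 < e / 2" by simp
  obtain n where n: "measure M ((\<Union>i. A i) - (\<Union>i<n. A i)) < e / 2"
    using exhaustion_small_remainder[of A, OF A e] by blast
  obtain E \<delta> where E: "E \<in> sets M" "\<delta> > 0" "measure M E < e / 2"
    "\<forall>i\<in>{..<n}. separated_off E \<delta> (A i)"
    using almost_separated_simultaneous[of "{..<n}" A, OF _ assms e] by blast
  define E' where "E' = E \<union> ((\<Union>i. A i) - (\<Union>i<n. A i))"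
  have R: "(\<Union>i. A i) - (\<Union>i<n. A i) \<in> sets M"
    using A by blast
  then have "E' \<in> sets M" "measure M E' < e"
    using measure_Un_le[OF E(1) R] E n by (auto simp: E'_def)
  moreover have "separated_off E' \<delta> (\<Union>i. A i)"
    using E(4) by (auto simp: separated_off_def E'_def)
  ultimately show "\<exists>E\<in>sets M. \<exists>\<delta>>0. measure M E < e \<and> separated_off E \<delta> (\<Union>i. A i)"
    using E by blast
qed

lemma almost_separated_borel:
  assumes "A \<in> borel_sets_of (qtopology X d)"
  shows "almost_separated A"
  using assms unfolding borel_sets_of_def topspace_qtopology
proof (induction rule: sigma_sets.induct)
  case (Basic U)
  then show ?case by (simp add: almost_separated_open)
next
  case Empty
  show ?case by (simp add: almost_separated_open)
next
  case (Compl A)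
  then show ?case by (simp add: almost_separated_compl)
next
  case (Union A)
  then show ?case by (simp add: almost_separated_UN)
qed

text \<open>
  A measurable set differs from some Borel superset by a null set (the measure being finite), and
  this difference can be added to the exceptional set.
\<close>

lemma almost_separated_measurable:
  assumes reg: "borel_regular (qtopology X d) M" and A: "A \<in> sets M"
  shows "almost_separated A"
  unfolding almost_separated_def
proof (intro conjI allI impI)
  show "A \<in> sets M" by fact
  fix e :: real assume e: "0 < e"
  obtain B where B: "B \<in> borel_sets_of (qtopology X d)" "A \<subseteq> B" "emeasure M A = emeasure M B"
    using reg A unfolding borel_regular_def by blast
  have sB: "almost_separated B" by (rule almost_separated_borel[OF B(1)])
  then have "B \<in> sets M" by (simp add: almost_separated_def)
  moreover have "measure M A = measure M B"
    using B(3) by (simp add: measure_def)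
  ultimately have diff: "B - A \<in> sets M" "measure M (B - A) = 0"
    using A B(2) by (simp_all add: finite_measure_Diff)
  obtain E \<delta> where E: "E \<in> sets M" "\<delta> > 0" "measure M E < e" "separated_off E \<delta> B"
    using sB e unfolding almost_separated_def by meson
  have "measure M (E \<union> (B - A)) < e"
    using measure_Un_le[OF E(1) diff(1)] diff(2) E(3) by simp
  moreover have "separated_off (E \<union> (B - A)) \<delta> A"
    using E(4) B(2) by (auto simp: separated_off_def)
  ultimately show "\<exists>E\<in>sets M. \<exists>\<delta>>0. measure M E < e \<and> separated_off E \<delta> A"
    using E diff(1) by blast
qed

section \<open>Necessity\<close>

text \<open>
  Off a set of small measure \<open>f\<close> is bounded, so \<open>\<lfloor>f / e\<rfloor>\<close> takes finitely many values there.  Its level sets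
  are almost separated, so two close points lie in the same one, where \<open>f\<close> oscillates by less than
  \<open>e\<close>.
\<close>

lemma almost_uniformly_continuous_bounded:
  assumes reg: "borel_regular (qtopology X d) M"
    and f: "f \<in> L0_functions M" and e: "0 < e"
  shows "\<exists>E\<in>sets M. \<exists>\<delta>>0. \<exists>\<Lambda>>0. measure M E < e \<and>
           (\<forall>x\<in>X - E. \<bar>f x\<bar> \<le> ereal \<Lambda>) \<and>
           (\<forall>x\<in>X - E. \<forall>y\<in>X - E. d x y < \<delta> \<longrightarrow>
              \<bar>real_of_ereal (f x) - real_of_ereal (f y)\<bar> < e)"
proof -
  have [measurable]: "f \<in> borel_measurable M"
    using f by (rule L0_functionsD)
  define g where "g x = real_of_ereal (f x)" for x
  have [measurable]: "g \<in> borel_measurable M"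
    unfolding g_def by measurable
  define T where "T n = {x \<in> space M. \<bar>f x\<bar> \<le> ereal (real n)}" for n
  have T: "T n \<in> sets M" for n
    unfolding T_def by measurable
  have half: "0 < e / 2" using e by simp
  obtain n where n: "measure M ((\<Union>n. T n) - (\<Union>k<n. T k)) < e / 2"
    using exhaustion_small_remainder[of T, OF T half] by blast
  define P where "P = {x \<in> space M. \<bar>f x\<bar> = \<infinity>}"
  have P: "P \<in> sets M" unfolding P_def by measurable
  have "measure M P = 0"
  proof -
    have "P \<in> null_sets M"
      using P L0_functionsD(2)[OF f] by (subst AE_iff_null_sets) (auto simp: P_def)
    then show ?thesis by (auto simp: measure_def null_sets_def)
  qed
  define L where "L = ((\<Union>n. T n) - (\<Union>k<n. T k)) \<union> P"
  have L: "L \<in> sets M" using T P by (auto simp: L_def)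
  have L_small: "measure M L < e / 2"
  proof -
    have "(\<Union>n. T n) - (\<Union>k<n. T k) \<in> sets M"
      using T by blast
    from measure_Un_le[OF this P] show ?thesis
      unfolding L_def using n \<open>measure M P = 0\<close> by linarith
  qed
  have bnd: "\<bar>f x\<bar> \<le> ereal (Suc n)" if x: "x \<in> X - L" for x
  proof -
    have "x \<notin> P" using x by (simp add: L_def)
    then obtain r where r: "f x = ereal r"
      using x by (cases "f x") (auto simp: P_def space_eq)
    obtain k where "\<bar>r\<bar> \<le> real k"
      using real_arch_simple by blast
    then have "x \<in> (\<Union>n. T n)"
      using x r by (auto simp: T_def space_eq)
    then obtain j where "j < n" "x \<in> T j"
      using x by (auto simp: L_def)
    then show ?thesis
      using r by (auto simp: T_def)
  qed
  define N where "N = {\<lfloor>- real (Suc n) / e\<rfloor>..\<lfloor>real (Suc n) / e\<rfloor>}"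
  define A where "A k = {x \<in> space M. \<lfloor>g x / e\<rfloor> = k}" for k :: int
  have "A k \<in> sets M" for k
    unfolding A_def by measurable
  then have "\<And>k. k \<in> N \<Longrightarrow> almost_separated (A k)"
    by (simp add: almost_separated_measurable[OF reg])
  moreover have "finite N" by (simp add: N_def)
  ultimately obtain E \<delta> where E: "E \<in> sets M" "\<delta> > 0" "measure M E < e / 2"
    "\<forall>k\<in>N. separated_off E \<delta> (A k)"
    using almost_separated_simultaneous[of N A, OF _ _ half] by blast
  have osc: "\<bar>g x - g y\<bar> < e" if x: "x \<in> X - (E \<union> L)" and y: "y \<in> X - (E \<union> L)"
    and xy: "d x y < \<delta>" for x y
  proof -
    define k where "k = \<lfloor>g x / e\<rfloor>"
    have "\<bar>f x\<bar> \<le> ereal (Suc n)" using bnd x by blast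
    then have "\<bar>g x\<bar> \<le> Suc n"
      by (cases "f x") (auto simp: g_def)
    then have "k \<in> N"
      using e unfolding N_def k_def atLeastAtMost_iff
      by (intro conjI floor_mono divide_right_mono) auto
    then have "separated_off E \<delta> (A k)" using E(4) by blast
    moreover have "x \<in> A k - E" using x by (simp add: A_def k_def space_eq)
    moreover have "y \<notin> X - A k - E" if "y \<in> A k" using that by blast
    ultimately have "y \<in> A k"
      using y xy unfolding separated_off_def by (metis DiffD1 DiffD2 DiffI UnCI not_less)
    then have "\<lfloor>g x / e\<rfloor> = \<lfloor>g y / e\<rfloor>"
      by (simp add: A_def k_def)
    then show ?thesis
      by (rule abs_diff_less_if_floor_eq[OF e])
  qed
  have "measure M (E \<union> L) < e"
    using measure_Un_le[OF E(1) L] E(3) L_small by linarith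
  then show ?thesis
    using E L bnd osc unfolding g_def
    by (intro bexI[of _ "E \<union> L"] exI[of _ \<delta>] exI[of _ "real (Suc n)"] conjI) auto
qed

text \<open>
  If \<open>u\<close> is near the net function \<open>v\<close>, then \<open>\<bar>u - v\<bar> < \<epsilon> / 3\<close> off a small set, and \<open>u\<close> inherits the
  uniform continuity and the bound of \<open>v\<close> there.
\<close>

lemma equicontinuous_if_mtotally_bounded:
  assumes reg: "borel_regular (qtopology X d) M"
    and F: "F \<subseteq> L0_space M"
    and tb: "Metric_space.mtotally_bounded (L0_space M) (L0_dist M) F"
  shows "uniformly_almost_equicontinuous_bounded X d M F"
  unfolding uniformly_almost_equicontinuous_bounded_def
proof (intro allI impI)
  interpret L0: Metric_space "L0_space M" "L0_dist M"
    by (rule Metric_space_L0) unfold_locales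
  fix \<epsilon> :: real assume \<epsilon>: "0 < \<epsilon>"
  define t where "t = \<epsilon> / 3"
  have t: "0 < t" using \<epsilon> by (simp add: t_def)
  \<comment> \<open>The radius for which Markov's inequality makes the set where \<open>\<bar>u - v\<bar> \<ge> t\<close> smaller than \<open>t\<close>.\<close>
  define \<eta> where "\<eta> = t * (t / (1 + t))"
  have \<eta>: "0 < \<eta>" using t by (simp add: \<eta>_def)
  obtain K where K: "finite K" "K \<subseteq> F" "F \<subseteq> (\<Union>V\<in>K. L0.mball V \<eta>)"
    using tb[unfolded L0.mtotally_bounded_def, rule_format, OF \<eta>] by (elim exE conjE) (rule that)
  define rep :: "('a \<Rightarrow> ereal) set \<Rightarrow> 'a \<Rightarrow> ereal" where "rep V = (SOME v. v \<in> V)" for V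
  have rep: "rep V \<in> V" "rep V \<in> L0_functions M" if "V \<in> K" for V
  proof -
    have V: "V \<in> L0_space M" using F K(2) that by blast
    show "rep V \<in> V" unfolding rep_def by (rule L0_space_some[OF V])
    then show "rep V \<in> L0_functions M" by (rule L0_space_representative[OF V])
  qed
  define good where "good V E \<delta> \<Lambda> \<longleftrightarrow> E \<in> sets M \<and> 0 < \<delta> \<and> 0 < \<Lambda> \<and> measure M E < t \<and>
           (\<forall>x\<in>X - E. \<bar>rep V x\<bar> \<le> ereal \<Lambda>) \<and>
           (\<forall>x\<in>X - E. \<forall>y\<in>X - E. d x y < \<delta> \<longrightarrow>
              \<bar>real_of_ereal (rep V x) - real_of_ereal (rep V y)\<bar> < t)" for V E \<delta> \<Lambda>
  have "\<exists>E \<delta> \<Lambda>. good V E \<delta> \<Lambda>" if "V \<in> K" for V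
    using almost_uniformly_continuous_bounded[OF reg rep(2)[OF that] t]
    unfolding good_def Bex_def by (elim exE conjE) (intro exI conjI; assumption)
  then obtain E \<delta> \<Lambda> where good: "\<And>V. V \<in> K \<Longrightarrow> good V (E V) (\<delta> V) (\<Lambda> V)"
    by metis
  have E: "E V \<in> sets M" "measure M (E V) < t" and \<delta>: "0 < \<delta> V" and \<Lambda>: "0 < \<Lambda> V"
    and bnd: "\<And>x. x \<in> X - E V \<Longrightarrow> \<bar>rep V x\<bar> \<le> ereal (\<Lambda> V)"
    and osc: "\<And>x y. x \<in> X - E V \<Longrightarrow> y \<in> X - E V \<Longrightarrow> d x y < \<delta> V \<Longrightarrow>
      \<bar>real_of_ereal (rep V x) - real_of_ereal (rep V y)\<bar> < t" if "V \<in> K" for V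
    using good[OF that] unfolding good_def by auto
  obtain \<delta>0 where \<delta>0: "0 < \<delta>0" "\<And>V. V \<in> K \<Longrightarrow> \<delta>0 \<le> \<delta> V"
    using finite_pos_lower_bound[OF K(1), of \<delta>] \<delta> by blast
  define \<Lambda>0 where "\<Lambda>0 = t + (\<Sum>V\<in>K. \<Lambda> V)"
  have \<Lambda>0: "\<Lambda> V + t \<le> \<Lambda>0" if "V \<in> K" for V
    using member_le_sum[OF that, of \<Lambda>] \<Lambda> K(1) by (fastforce simp: \<Lambda>0_def intro: less_imp_le)
  have \<Lambda>0_pos: "0 < \<Lambda>0"
    using t sum_nonneg[of K \<Lambda>, OF less_imp_le[OF \<Lambda>]] by (simp add: \<Lambda>0_def add_pos_nonneg)
  have main: "\<exists>E\<in>sets M. emeasure M E < ennreal \<epsilon> \<and>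
        (\<forall>x\<in>X - E. \<forall>y\<in>X - E. d x y < \<delta>0 \<longrightarrow> \<bar>u x - u y\<bar> < ereal \<epsilon>) \<and>
        (\<forall>x\<in>X - E. \<bar>u x\<bar> \<le> ereal \<Lambda>0)" if U: "U \<in> F" and u: "u \<in> U" for U u
  proof -
    obtain V where VK: "V \<in> K" and "U \<in> L0.mball V \<eta>"
      using K(3) U by blast
    then have V: "V \<in> K" "V \<in> L0_space M" "U \<in> L0_space M" "L0_dist M V U < \<eta>"
      by simp_all
    have uL: "u \<in> L0_functions M"
      using L0_space_representative V(3) u by blast
    then have [measurable]: "u \<in> borel_measurable M" "rep V \<in> borel_measurable M"
      using rep(2)[OF V(1)] by (auto dest: L0_functionsD)
    have dist: "L0_fun_dist M (rep V) u < \<eta>"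
      using L0_dist_eq[OF V(2,3) rep(1)[OF V(1)] u] V(4) by simp
    define Q where "Q = {x \<in> space M. t \<le> \<bar>real_of_ereal (rep V x) - real_of_ereal (u x)\<bar>}"
    define P where "P = {x \<in> space M. \<bar>u x\<bar> = \<infinity>}"
    have Q: "Q \<in> sets M" unfolding Q_def by measurable
    have P: "P \<in> sets M" unfolding P_def by measurable
    have "P \<in> null_sets M"
      using P L0_functionsD(2)[OF uL] by (subst AE_iff_null_sets) (auto simp: P_def)
    then have P0: "measure M P = 0" by (auto simp: measure_def null_sets_def)
    have "measure M Q \<le> L0_fun_dist M (rep V) u * ((1 + t) / t)"
      unfolding Q_def by (rule measure_L0_far_le[OF rep(2)[OF V(1)] uL t])
    also have "\<dots> < \<eta> * ((1 + t) / t)"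
      using dist t by (intro mult_strict_right_mono) auto
    also have "\<dots> = t"
      using t by (simp add: \<eta>_def)
    finally have Q_small: "measure M Q < t" .
    let ?E = "E V \<union> Q \<union> P"
    have sets: "?E \<in> sets M" using E(1) V(1) P Q by blast
    have "measure M ?E \<le> measure M (E V) + measure M Q + measure M P"
      using measure_Un_le[OF sets.Un[OF E(1)[OF V(1)] Q] P] measure_Un_le[OF E(1)[OF V(1)] Q]
      by linarith
    also have "\<dots> < \<epsilon>"
      using E(2)[OF V(1)] Q_small P0 \<epsilon> unfolding t_def by linarith
    finally have "emeasure M ?E < ennreal \<epsilon>"
      using \<epsilon> by (simp add: emeasure_eq_measure ennreal_less_iff)
    moreover have near: "\<exists>a. u x = ereal a \<and> \<bar>real_of_ereal (rep V x) - a\<bar> < t"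
      if "x \<in> X - ?E" for x
      using that by (cases "u x") (auto simp: P_def Q_def space_eq)
    have "\<bar>u x - u y\<bar> < ereal \<epsilon>" if x: "x \<in> X - ?E" and y: "y \<in> X - ?E" and xy: "d x y < \<delta>0" for x y
    proof -
      obtain a where a: "u x = ereal a" "\<bar>real_of_ereal (rep V x) - a\<bar> < t"
        using near[OF x] by blast
      obtain b where b: "u y = ereal b" "\<bar>real_of_ereal (rep V y) - b\<bar> < t"
        using near[OF y] by blast
      have "\<bar>real_of_ereal (rep V x) - real_of_ereal (rep V y)\<bar> < t"
        using osc[OF V(1), of x y] x y xy \<delta>0(2)[OF V(1)] by auto
      then have "\<bar>a - b\<bar> < \<epsilon>"
        using a(2) b(2) unfolding t_def by linarith
      then show ?thesis using a b by simp
    qed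
    moreover have "\<bar>u x\<bar> \<le> ereal \<Lambda>0" if x: "x \<in> X - ?E" for x
    proof -
      obtain a where a: "u x = ereal a" "\<bar>real_of_ereal (rep V x) - a\<bar> < t"
        using near[OF x] by blast
      have "\<bar>rep V x\<bar> \<le> ereal (\<Lambda> V)" using bnd[OF V(1)] x by blast
      then have "\<bar>real_of_ereal (rep V x)\<bar> \<le> \<Lambda> V"
        by (cases "rep V x") auto
      then have "\<bar>a\<bar> \<le> \<Lambda>0"
        using a(2) \<Lambda>0[OF V(1)] by linarith
      then show ?thesis using a by simp
    qed
    ultimately show ?thesis using sets by blast
  qed
  show "\<exists>\<delta>>0. \<exists>\<Lambda>>0. \<forall>U\<in>F. \<forall>u\<in>U. \<exists>E\<in>sets M. emeasure M E < ennreal \<epsilon> \<and>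
        (\<forall>x\<in>X - E. \<forall>y\<in>X - E. d x y < \<delta> \<longrightarrow> \<bar>u x - u y\<bar> < ereal \<epsilon>) \<and>
        (\<forall>x\<in>X - E. \<bar>u x\<bar> \<le> ereal \<Lambda>)"
    using \<delta>0(1) \<Lambda>0_pos main by blast
qed

end

theorem theorem5p3:
  fixes X :: "'a set" and d :: "'a \<Rightarrow> 'a \<Rightarrow> real" and M :: "'a measure"
    and F :: "('a \<Rightarrow> ereal) set set"
  assumes "quasi_metric_space X d"
    and "separable_topology (qtopology X d)"
    and "borel_measure_on (qtopology X d) M"
    and "emeasure M X < \<infinity>"
    and "F \<subseteq> L0_space M"
  shows "(uniformly_almost_equicontinuous_bounded X d M F \<longrightarrow>
            Metric_space.mtotally_bounded (L0_space M) (L0_dist M) F) \<and>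
         (borel_regular (qtopology X d) M \<and>
          (\<forall>U. openin (qtopology X d) U \<longrightarrow>
             (\<exists>S Z. fsigma_in (qtopology X d) S \<and> Z \<in> null_sets M \<and> U = S \<union> Z)) \<longrightarrow>
          Metric_space.mtotally_bounded (L0_space M) (L0_dist M) F \<longrightarrow>
            uniformly_almost_equicontinuous_bounded X d M F)"
proof -
  obtain C0 C1 where C: "C0 > 0" "C1 > 0" "\<forall>x\<in>X. \<forall>y\<in>X. \<forall>z\<in>X.
        (d x y = 0 \<longleftrightarrow> x = y) \<and> d y x \<le> C0 * d x y \<and> d x y \<le> C1 * max (d x z) (d z y)"
    using assms(1) unfolding quasi_metric_space_def by blast
  have space: "space M = X" and borel: "borel_sets_of (qtopology X d) \<subseteq> sets M"
    using assms(3) by (auto simp: borel_measure_on_def)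
  interpret finite_measure M
    by (rule finite_measureI) (use assms(4) space in auto)
  interpret finite_quasi_metric_measure X d C0 C1 M
  proof unfold_locales
    show "X \<noteq> {}"
      using assms(1) by (auto simp: quasi_metric_space_def)
    show "U \<in> sets M" if "openin (qtopology X d) U" for U
      using borel that by (auto simp: borel_sets_of_def)
  qed (use C space in auto)
  show ?thesis
    using mtotally_bounded_if_equicontinuous[OF assms(2,5)]
      equicontinuous_if_mtotally_bounded[OF _ assms(5)] by blast
qed

end
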